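(* Let $G$ be a countable sofic group acting continuously on a compact metrizable space $X$, and let $\Sigma$ be a sofic approximation sequence for $G$. Then $$\mathrm{mdim}_\Sigma(X)\le\mathrm{mdim}_{\Sigma,\mathrm M}(X).$$
   Context: Sofic approximations. For $d\in\mathbb N$ write $[d]=\{1,\dots,d\}$ and $\mathrm{Sym}(d)$ for the permutation group of $[d]$. A sofic approximation sequence for a countable group $G$ is a sequence of maps $\Sigma=\{\sigma_i:G\to\mathrm{Sym}(d_i)\}_{i=1}^\infty$ such that: (1) for all $s,t\in G$, $\lim_i |\{a\in[d_i]:\sigma_i(s)\sigma_i(t)(a)=\sigma_i(st)(a)\}|/d_i=1$; (2) for all distinct $s,t\in G$, $\lim_i|\{a\in[d_i]:\sigma_i(s)(a)=\sigma_i(t)(a)\}|/d_i=0$; (3) $\lim_i d_i=+\infty$. $G$ is sofic if it has such a sequence. We write $\sigma_s=\sigma(s)$. Order and $\mathcal D$. For finite open covers of a compact space $Y$, $\mathcal V\succ\mathcal U$ means every element of $\mathcal V$ is contained in some element of $\mathcal U$. Put $\mathrm{ord}(\mathcal U)=\max_{y\in Y}\sum_{U\in\mathcal U}1_U(y)-1$ and $\mathcal D(\mathcal U)=\min_{\mathcal V\succ\mathcal U}\mathrm{ord}(\mathcal V)$, the minimum over finite open covers $\mathcal V$ of $Y$ refining $\mathcal U$. Map spaces. Let $G$ act continuously on a compact metrizable space $X$ by $\alpha$, and let $\rho$ be a compatible metric on $X$. For maps $\varphi,\psi:[d]\to X$ put $\rho_2(\varphi,\psi)=\big(\frac1d\sum_{a\in[d]}\rho(\varphi(a),\psi(a))^2\big)^{1/2}$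 and $\rho_\infty(\varphi,\psi)=\max_{a\in[d]}\rho(\varphi(a),\psi(a))$. For a nonempty finite $F\subseteq G$, $\delta>0$, and a map $\sigma:G\to\mathrm{Sym}(d)$, $\mathrm{Map}(\rho,F,\delta,\sigma)$ is the set of all $\varphi:[d]\to X$ with $\rho_2(\varphi\circ\sigma_s,\alpha_s\circ\varphi)\le\delta$ for all $s\in F$, a closed subspace of $X^{[d]}$. Sofic mean topological dimension. For a finite open cover $\mathcal U$ of $X$, $\mathcal U^d$ is the open cover of $X^{[d]}$ by the sets $U_1\times\cdots\times U_d$, $U_j\in\mathcal U$. Let $\mathcal D(\mathcal U,\rho,F,\delta,\sigma)=\mathcal D(\mathcal U^d|_{\mathrm{Map}(\rho,F,\delta,\sigma)})$, where $|$ denotes the restricted cover. Put $\mathcal D_\Sigma(\mathcal U,\rho,F,\delta)=\varlimsup_{i\to\infty}\mathcal D(\mathcal U,\rho,F,\delta,\sigma_i)/d_i$, set to $-\infty$ if $\mathrm{Map}(\rho,F,\delta,\sigma_i)$ is empty for all sufficiently large $i$; $\mathcal D_\Sigma(\mathcal U)=\inf_F\inf_{\delta>0}\mathcal D_\Sigma(\mathcal U,\rho,F,\delta)$ over nonempty finite $F\subseteq G$ and $\delta>0$ (this does not depend on the choice of $\rho$); and $\mathrm{mdim}_\Sigma(X)=\sup_{\mathcal U}\mathcal D_\Sigma(\mathcal U)$ over finite open covers $\mathcal U$ of $X$. Sofic metric mean dimension. For a metric space $(Y,\rho)$ and $\varepsilon>0$, a subset $Z\subseteq Y$ is $(\rho,\varepsilon)$-separated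 if $\rho(y,z)\ge\varepsilon$ for all distinct $y,z\in Z$; $N_\varepsilon(Y,\rho)$ is the maximal cardinality of $(\rho,\varepsilon)$-separated subsets of $Y$. Put $h^\varepsilon_{\Sigma,\infty}(\rho,F,\delta)=\varlimsup_{i\to\infty}\frac1{d_i}\log N_\varepsilon(\mathrm{Map}(\rho,F,\delta,\sigma_i),\rho_\infty)$, set to $-\infty$ if $\mathrm{Map}(\rho,F,\delta,\sigma_i)$ is empty for all sufficiently large $i$; $h^\varepsilon_{\Sigma,\infty}(\rho)=\inf_F\inf_{\delta>0}h^\varepsilon_{\Sigma,\infty}(\rho,F,\delta)$; $\mathrm{mdim}_{\Sigma,\mathrm M}(X,\rho)=\varliminf_{\varepsilon\to0}\frac{1}{|\log\varepsilon|}h^\varepsilon_{\Sigma,\infty}(\rho)$; and $\mathrm{mdim}_{\Sigma,\mathrm M}(X)=\inf_\rho\mathrm{mdim}_{\Sigma,\mathrm M}(X,\rho)$ over compatible metrics $\rho$ on $X$. *)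

theory Defs
  imports "HOL-Analysis.Analysis" "HOL-Algebra.Group_Action"
begin

definition sofic_approximation ::
    "('g, 'm) monoid_scheme \<Rightarrow> (nat \<Rightarrow> nat) \<Rightarrow> (nat \<Rightarrow> 'g \<Rightarrow> nat \<Rightarrow> nat) \<Rightarrow> bool" where
  "sofic_approximation G d \<sigma> \<longleftrightarrow>
     (\<forall>i. \<forall>s\<in>carrier G. \<sigma> i s permutes {1..d i}) \<and>
     (\<forall>s\<in>carrier G. \<forall>t\<in>carrier G.
        (\<lambda>i. real (card {a\<in>{1..d i}. \<sigma> i s (\<sigma> i t a) = \<sigma> i (s \<otimes>\<^bsub>G\<^esub> t) a}) / real (d i))
          \<longlonglongrightarrow> 1) \<and>
     (\<forall>s\<in>carrier G. \<forall>t\<in>carrier G. s \<noteq> t \<longrightarrow>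
        (\<lambda>i. real (card {a\<in>{1..d i}. \<sigma> i s a = \<sigma> i t a}) / real (d i)) \<longlonglongrightarrow> 0) \<and>
     filterlim d at_top sequentially"

definition continuous_group_action ::
    "('g, 'm) monoid_scheme \<Rightarrow> 'x topology \<Rightarrow> ('g \<Rightarrow> 'x \<Rightarrow> 'x) \<Rightarrow> bool" where
  "continuous_group_action G X \<alpha> \<longleftrightarrow>
     group_action G (topspace X) \<alpha> \<and> (\<forall>s\<in>carrier G. continuous_map X X (\<alpha> s))"

definition compatible_metric :: "'x topology \<Rightarrow> ('x \<Rightarrow> 'x \<Rightarrow> real) \<Rightarrow> bool" where
  "compatible_metric X \<rho> \<longleftrightarrow>
     Metric_space (topspace X) \<rho> \<and> Metric_space.mtopology (topspace X) \<rho> = X"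

definition finite_open_cover :: "'y topology \<Rightarrow> 'y set set \<Rightarrow> bool" where
  "finite_open_cover Y \<U> \<longleftrightarrow> finite \<U> \<and> (\<forall>U\<in>\<U>. openin Y U) \<and> \<Union>\<U> = topspace Y"

definition refines :: "'y set set \<Rightarrow> 'y set set \<Rightarrow> bool" where
  "refines \<V> \<U> \<longleftrightarrow> (\<forall>V\<in>\<V>. \<exists>U\<in>\<U>. V \<subseteq> U)"

text \<open>For a finite cover the supremum is taken over a bounded set of natural numbers, so it is a
  maximum; the empty space gets order \<open>-1\<close>. Likewise the infimum below is over a nonempty set of
  integers bounded below by \<open>-1\<close>, so it is a minimum.\<close>

definition cover_ord :: "'y topology \<Rightarrow> 'y set set \<Rightarrow> int" where
  "cover_ord Y \<U> = int (SUP y\<in>topspace Y. \<Sum>U\<in>\<U>. indicator U y) - 1"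

definition cover_D :: "'y topology \<Rightarrow> 'y set set \<Rightarrow> int" where
  "cover_D Y \<U> = (INF \<V>\<in>{\<V>. finite_open_cover Y \<V> \<and> refines \<V> \<U>}. cover_ord Y \<V>)"

definition rho_2 :: "('x \<Rightarrow> 'x \<Rightarrow> real) \<Rightarrow> nat \<Rightarrow> (nat \<Rightarrow> 'x) \<Rightarrow> (nat \<Rightarrow> 'x) \<Rightarrow> real" where
  "rho_2 \<rho> d \<phi> \<psi> = sqrt (1 / real d * (\<Sum>a\<in>{1..d}. (\<rho> (\<phi> a) (\<psi> a))\<^sup>2))"

definition rho_infty :: "('x \<Rightarrow> 'x \<Rightarrow> real) \<Rightarrow> nat \<Rightarrow> (nat \<Rightarrow> 'x) \<Rightarrow> (nat \<Rightarrow> 'x) \<Rightarrow> real" where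
  "rho_infty \<rho> d \<phi> \<psi> = Max ((\<lambda>a. \<rho> (\<phi> a) (\<psi> a)) ` {1..d})"

text \<open>Maps \<open>[d] \<rightarrow> X\<close> are the extensional functions on \<open>{1..d}\<close>, i.e. the points of
  \<open>product_topology (\<lambda>_. X) {1..d}\<close>.\<close>

definition Map_space ::
    "'x topology \<Rightarrow> ('g \<Rightarrow> 'x \<Rightarrow> 'x) \<Rightarrow> ('x \<Rightarrow> 'x \<Rightarrow> real) \<Rightarrow> 'g set \<Rightarrow> real \<Rightarrow>
     nat \<Rightarrow> ('g \<Rightarrow> nat \<Rightarrow> nat) \<Rightarrow> (nat \<Rightarrow> 'x) set" where
  "Map_space X \<alpha> \<rho> F \<delta> d \<sigma> =
     {\<phi> \<in> {1..d} \<rightarrow>\<^sub>E topspace X. \<forall>s\<in>F. rho_2 \<rho> d (\<phi> \<circ> \<sigma> s) (\<alpha> s \<circ> \<phi>) \<le> \<delta>}"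

definition power_cover :: "nat \<Rightarrow> 'x set set \<Rightarrow> (nat \<Rightarrow> 'x) set set" where
  "power_cover d \<U> = (\<lambda>u. \<Pi>\<^sub>E a\<in>{1..d}. u a) ` ({1..d} \<rightarrow>\<^sub>E \<U>)"

definition Map_D ::
    "'x topology \<Rightarrow> ('g \<Rightarrow> 'x \<Rightarrow> 'x) \<Rightarrow> 'x set set \<Rightarrow> ('x \<Rightarrow> 'x \<Rightarrow> real) \<Rightarrow> 'g set \<Rightarrow> real \<Rightarrow>
     nat \<Rightarrow> ('g \<Rightarrow> nat \<Rightarrow> nat) \<Rightarrow> int" where
  "Map_D X \<alpha> \<U> \<rho> F \<delta> d \<sigma> =
     cover_D (subtopology (product_topology (\<lambda>_. X) {1..d}) (Map_space X \<alpha> \<rho> F \<delta> d \<sigma>))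
       ((\<lambda>W. W \<inter> Map_space X \<alpha> \<rho> F \<delta> d \<sigma>) ` power_cover d \<U>)"

definition D_Sigma_at ::
    "'x topology \<Rightarrow> ('g \<Rightarrow> 'x \<Rightarrow> 'x) \<Rightarrow> (nat \<Rightarrow> nat) \<Rightarrow> (nat \<Rightarrow> 'g \<Rightarrow> nat \<Rightarrow> nat) \<Rightarrow>
     'x set set \<Rightarrow> ('x \<Rightarrow> 'x \<Rightarrow> real) \<Rightarrow> 'g set \<Rightarrow> real \<Rightarrow> ereal" where
  "D_Sigma_at X \<alpha> d \<sigma> \<U> \<rho> F \<delta> =
     (if \<forall>\<^sub>F i in sequentially. Map_space X \<alpha> \<rho> F \<delta> (d i) (\<sigma> i) = {} then -\<infinity>
      else limsup (\<lambda>i. ereal (real_of_int (Map_D X \<alpha> \<U> \<rho> F \<delta> (d i) (\<sigma> i)) / real (d i))))"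

definition D_Sigma ::
    "('g, 'm) monoid_scheme \<Rightarrow> 'x topology \<Rightarrow> ('g \<Rightarrow> 'x \<Rightarrow> 'x) \<Rightarrow> (nat \<Rightarrow> nat) \<Rightarrow>
     (nat \<Rightarrow> 'g \<Rightarrow> nat \<Rightarrow> nat) \<Rightarrow> ('x \<Rightarrow> 'x \<Rightarrow> real) \<Rightarrow> 'x set set \<Rightarrow> ereal" where
  "D_Sigma G X \<alpha> d \<sigma> \<rho> \<U> =
     (INF F\<in>{F. F \<subseteq> carrier G \<and> finite F \<and> F \<noteq> {}}. INF \<delta>\<in>{0<..}. D_Sigma_at X \<alpha> d \<sigma> \<U> \<rho> F \<delta>)"

text \<open>The value does not depend on the compatible metric \<open>\<rho>\<close>, but as this is a fact to be proved,
  \<open>\<rho>\<close> is kept as an argument.\<close>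

definition sofic_mdim ::
    "('g, 'm) monoid_scheme \<Rightarrow> 'x topology \<Rightarrow> ('g \<Rightarrow> 'x \<Rightarrow> 'x) \<Rightarrow> (nat \<Rightarrow> nat) \<Rightarrow>
     (nat \<Rightarrow> 'g \<Rightarrow> nat \<Rightarrow> nat) \<Rightarrow> ('x \<Rightarrow> 'x \<Rightarrow> real) \<Rightarrow> ereal" where
  "sofic_mdim G X \<alpha> d \<sigma> \<rho> = (SUP \<U>\<in>{\<U>. finite_open_cover X \<U>}. D_Sigma G X \<alpha> d \<sigma> \<rho> \<U>)"

definition separated_set :: "('y \<Rightarrow> 'y \<Rightarrow> real) \<Rightarrow> real \<Rightarrow> 'y set \<Rightarrow> bool" where
  "separated_set \<rho> \<epsilon> Z \<longleftrightarrow> (\<forall>y\<in>Z. \<forall>z\<in>Z. y \<noteq> z \<longrightarrow> \<epsilon> \<le> \<rho> y z)"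

text \<open>Only meaningful when the cardinalities are bounded, e.g. for \<open>Y\<close> compact under \<open>\<rho>\<close>.\<close>

definition sep_number :: "real \<Rightarrow> 'y set \<Rightarrow> ('y \<Rightarrow> 'y \<Rightarrow> real) \<Rightarrow> nat" where
  "sep_number \<epsilon> Y \<rho> = Max (card ` {Z. Z \<subseteq> Y \<and> finite Z \<and> separated_set \<rho> \<epsilon> Z})"

definition h_Sigma_at ::
    "'x topology \<Rightarrow> ('g \<Rightarrow> 'x \<Rightarrow> 'x) \<Rightarrow> (nat \<Rightarrow> nat) \<Rightarrow> (nat \<Rightarrow> 'g \<Rightarrow> nat \<Rightarrow> nat) \<Rightarrow>
     real \<Rightarrow> ('x \<Rightarrow> 'x \<Rightarrow> real) \<Rightarrow> 'g set \<Rightarrow> real \<Rightarrow> ereal" where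
  "h_Sigma_at X \<alpha> d \<sigma> \<epsilon> \<rho> F \<delta> =
     (if \<forall>\<^sub>F i in sequentially. Map_space X \<alpha> \<rho> F \<delta> (d i) (\<sigma> i) = {} then -\<infinity>
      else limsup (\<lambda>i. ereal (1 / real (d i) *
        ln (real (sep_number \<epsilon> (Map_space X \<alpha> \<rho> F \<delta> (d i) (\<sigma> i)) (rho_infty \<rho> (d i)))))))"

definition h_Sigma ::
    "('g, 'm) monoid_scheme \<Rightarrow> 'x topology \<Rightarrow> ('g \<Rightarrow> 'x \<Rightarrow> 'x) \<Rightarrow> (nat \<Rightarrow> nat) \<Rightarrow>
     (nat \<Rightarrow> 'g \<Rightarrow> nat \<Rightarrow> nat) \<Rightarrow> real \<Rightarrow> ('x \<Rightarrow> 'x \<Rightarrow> real) \<Rightarrow> ereal" where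
  "h_Sigma G X \<alpha> d \<sigma> \<epsilon> \<rho> =
     (INF F\<in>{F. F \<subseteq> carrier G \<and> finite F \<and> F \<noteq> {}}. INF \<delta>\<in>{0<..}. h_Sigma_at X \<alpha> d \<sigma> \<epsilon> \<rho> F \<delta>)"

definition sofic_metric_mdim_at ::
    "('g, 'm) monoid_scheme \<Rightarrow> 'x topology \<Rightarrow> ('g \<Rightarrow> 'x \<Rightarrow> 'x) \<Rightarrow> (nat \<Rightarrow> nat) \<Rightarrow>
     (nat \<Rightarrow> 'g \<Rightarrow> nat \<Rightarrow> nat) \<Rightarrow> ('x \<Rightarrow> 'x \<Rightarrow> real) \<Rightarrow> ereal" where
  "sofic_metric_mdim_at G X \<alpha> d \<sigma> \<rho> =
     Liminf (at_right 0) (\<lambda>\<epsilon>. h_Sigma G X \<alpha> d \<sigma> \<epsilon> \<rho> / ereal \<bar>ln \<epsilon>\<bar>)"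

definition sofic_metric_mdim ::
    "('g, 'm) monoid_scheme \<Rightarrow> 'x topology \<Rightarrow> ('g \<Rightarrow> 'x \<Rightarrow> 'x) \<Rightarrow> (nat \<Rightarrow> nat) \<Rightarrow>
     (nat \<Rightarrow> 'g \<Rightarrow> nat \<Rightarrow> nat) \<Rightarrow> ereal" where
  "sofic_metric_mdim G X \<alpha> d \<sigma> =
     (INF \<rho>\<in>{\<rho>. compatible_metric X \<rho>}. sofic_metric_mdim_at G X \<alpha> d \<sigma> \<rho>)"

end

theory Submission
  imports Defs "HOL-Real_Asymp.Real_Asymp"
begin

text \<open>Fix a cover \<open>\<U>\<close> with \<open>k\<close> members and Lipschitz functions subordinate to it. They map
  \<open>Map(\<rho>, F, \<delta>, \<sigma>)\<close> into a cube with \<open>k d\<close> coordinates, and the image is covered by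
  \<open>N\<^sub>\<epsilon>\<close> small cubes of side proportional to \<open>\<epsilon>\<close>. Counting over a grid with
  \<open>q \<sim> 1 / \<epsilon>\<close> values per coordinate yields, as soon as \<open>2 ^ (k d) * N\<^sub>\<epsilon> < q ^ (m + 1)\<close>, a grid
  point \<open>\<xi>\<close> with which no point of the image shares more than \<open>m\<close> coordinates. Cutting the cube
  at \<open>\<xi>\<close> then gives a refinement of \<open>\<U>\<^sup>d\<close> of order at most \<open>m\<close>, so that
  \<open>\<D> / d \<le> (k ln 2 + ln N\<^sub>\<epsilon> / d) / ln q\<close>, and \<open>\<epsilon> \<rightarrow> 0\<close> removes the
  term \<open>k ln 2\<close>. Passing between two compatible metrics only shrinks \<open>\<delta>\<close>.\<close>

section \<open>Open covers of small order\<close>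

lemma cover_D_le_cover_ord:
  assumes "finite_open_cover Y \<V>" "refines \<V> \<U>"
  shows "cover_D Y \<U> \<le> cover_ord Y \<V>"
  unfolding cover_D_def
proof (rule cINF_lower)
  show "bdd_below (cover_ord Y ` {\<V>. finite_open_cover Y \<V> \<and> refines \<V> \<U>})"
    by (rule bdd_belowI[of _ "-1"]) (auto simp: cover_ord_def)
qed (use assms in auto)

lemma cover_ord_le:
  assumes "finite \<V>" "\<And>y. y \<in> topspace Y \<Longrightarrow> card {V \<in> \<V>. y \<in> V} \<le> Suc m"
  shows "cover_ord Y \<V> \<le> int m"
proof -
  have eq: "(\<Sum>U\<in>\<V>. indicator U y :: nat) = card {V \<in> \<V>. y \<in> V}" for y
    using assms(1) by (simp add: indicator_def sum.If_cases Int_def)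
  have "(SUP y\<in>topspace Y. \<Sum>U\<in>\<V>. indicator U y :: nat) \<le> Suc m"
  \<comment> \<open>On the empty space the supremum of naturals has the default value 0, while
    \<open>cSUP_least\<close> asks for a nonempty index set.\<close>
  proof (cases "topspace Y = {}")
    case False
    then show ?thesis
      unfolding eq using assms(2) by (rule cSUP_least)
  qed simp
  then show ?thesis
    unfolding cover_ord_def by linarith
qed

text \<open>The point \<open>\<xi>\<close> cuts the cube along the hyperplanes \<open>x\<^sub>c = \<xi>\<^sub>c\<close>. A member of the cover
  is given by the set \<open>A\<close> of the coordinates closest to \<open>\<xi>\<close> and the set \<open>B\<close> of the remaining
  coordinates that exceed \<open>\<xi>\<close>. A point determines \<open>A\<close> from \<open>card A\<close>, so members with equal
  \<open>card A\<close> are disjoint; hence the order is at most \<open>m\<close> and not \<open>2 ^ m - 1\<close>.\<close>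

lemma cover_D_le_of_few_coincidences:
  fixes f :: "'c \<Rightarrow> 'y \<Rightarrow> real" and \<xi> :: "'c \<Rightarrow> real"
  assumes fin: "finite I"
    and cont: "\<And>c. c \<in> I \<Longrightarrow> continuous_map Y euclideanreal (f c)"
    and \<xi>: "\<And>c. c \<in> I \<Longrightarrow> \<xi> c < 1"
    and few: "\<And>y. y \<in> topspace Y \<Longrightarrow> card {c \<in> I. f c y = \<xi> c} \<le> m"
    and ref: "\<And>y. y \<in> topspace Y \<Longrightarrow> \<exists>W\<in>\<W>. \<forall>z\<in>topspace Y.
                (\<forall>c\<in>I. 1 \<le> f c y \<longrightarrow> \<xi> c < f c z) \<longrightarrow> z \<in> W"
  shows "cover_D Y \<W> \<le> int m"
proof -
  \<comment> \<open>Requiring \<open>f c y < 1\<close> on \<open>A\<close> serves the refinement: a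
    coordinate that reaches 1 at some point of a member cannot lie in \<open>A\<close>, and as \<xi>
    is below 1 it must lie in \<open>B\<close>, so it exceeds \<xi> on the whole member.\<close>
  define V where "V = (\<lambda>(A, B). {y \<in> topspace Y.
      (\<forall>c\<in>A. f c y < 1) \<and> (\<forall>c\<in>A. \<forall>c'\<in>I - A. \<bar>f c y - \<xi> c\<bar> < \<bar>f c' y - \<xi> c'\<bar>) \<and>
      (\<forall>c\<in>B. \<xi> c < f c y) \<and> (\<forall>c\<in>I - A - B. f c y < \<xi> c)})"
  define J where "J = {(A, B). A \<subseteq> I \<and> card A \<le> m \<and> B \<subseteq> I - A}"
  \<comment> \<open>Empty members are dropped because \<open>ref\<close> is to be applied at some
    point of each member.\<close>
  define \<V> where "\<V> = V ` J - {{}}"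
  have finJ: "finite J"
    by (rule finite_subset[of _ "Pow I \<times> Pow I"]) (auto simp: J_def fin)
  have opn: "openin Y (V p)" if "p \<in> J" for p
  proof -
    obtain A B where p: "p = (A, B)"
      by (metis surj_pair)
    with that have A: "A \<subseteq> I" and B: "B \<subseteq> I"
      by (auto simp: J_def)
    have finAB: "finite A" "finite B"
      using A B fin finite_subset by blast+
    have ball: "openin Y {y \<in> topspace Y. \<forall>c\<in>S. P c y}"
      if "finite S" "\<And>c. c \<in> S \<Longrightarrow> openin Y {y \<in> topspace Y. P c y}" for S :: "'c set" and P
    proof -
      have "{y \<in> topspace Y. \<forall>c\<in>S. P c y} = (\<Inter>c\<in>S. {y \<in> topspace Y. P c y}) \<inter> topspace Y"
        by auto
      then show ?thesis
        using that by (cases "S = {}") (auto intro!: openin_Int openin_INT)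
    qed
    have less: "openin Y {y \<in> topspace Y. g y < h y}"
      if "continuous_map Y euclideanreal g" "continuous_map Y euclideanreal h" for g h
    proof -
      have "continuous_map Y euclideanreal (\<lambda>y. h y - g y)"
        using that by (intro continuous_map_diff)
      from openin_continuous_map_preimage[OF this, of "{0<..}"] show ?thesis
        by simp
    qed
    have o1: "openin Y {y \<in> topspace Y. \<forall>c\<in>A. f c y < 1}"
      using A by (intro ball less finAB continuous_map_canonical_const cont) auto
    have o2: "openin Y {y \<in> topspace Y. \<forall>c\<in>A. \<forall>c'\<in>I - A. \<bar>f c y - \<xi> c\<bar> < \<bar>f c' y - \<xi> c'\<bar>}"
      using A fin by (intro ball less finAB continuous_map_canonical_const continuous_map_real_abs
          continuous_map_diff cont) auto
    have o3: "openin Y {y \<in> topspace Y. \<forall>c\<in>B. \<xi> c < f c y}"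
      using B by (intro ball less finAB continuous_map_canonical_const cont) auto
    have o4: "openin Y {y \<in> topspace Y. \<forall>c\<in>I - A - B. f c y < \<xi> c}"
      using fin by (intro ball less continuous_map_canonical_const cont) auto
    have "V p = {y \<in> topspace Y. \<forall>c\<in>A. f c y < 1} \<inter>
        {y \<in> topspace Y. \<forall>c\<in>A. \<forall>c'\<in>I - A. \<bar>f c y - \<xi> c\<bar> < \<bar>f c' y - \<xi> c'\<bar>} \<inter>
        {y \<in> topspace Y. \<forall>c\<in>B. \<xi> c < f c y} \<inter> {y \<in> topspace Y. \<forall>c\<in>I - A - B. f c y < \<xi> c}"
      by (auto simp: V_def p)
    then show ?thesis
      using o1 o2 o3 o4 by (simp only: openin_Int)
  qed
  have covers: "y \<in> \<Union>\<V>" if y: "y \<in> topspace Y" for y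
  proof -
    \<comment> \<open>At \<open>y\<close> the exact coincidences have distance 0 and all other
      coordinates a positive distance, so this \<open>A\<close> consists of the closest coordinates,
      and \<open>few\<close> bounds its size.\<close>
    define A where "A = {c \<in> I. f c y = \<xi> c}"
    define B where "B = {c \<in> I. \<xi> c < f c y}"
    have "(A, B) \<in> J"
      using few[OF y] by (auto simp: J_def A_def B_def)
    moreover have "y \<in> V (A, B)"
      using y \<xi> by (auto simp: V_def A_def B_def)
    ultimately show ?thesis
      by (auto simp: \<V>_def)
  qed
  have "\<Union>\<V> \<subseteq> topspace Y"
    by (auto simp: \<V>_def V_def)
  with covers have "\<Union>\<V> = topspace Y"
    by blast
  then have cover: "finite_open_cover Y \<V>"
    using opn finJ by (auto simp: finite_open_cover_def \<V>_def)
  have "\<exists>W\<in>\<W>. U \<subseteq> W" if U_in: "U \<in> \<V>" for U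
  proof -
    obtain p y where "U = V p" "y \<in> V p"
      using U_in unfolding \<V>_def by blast
    then obtain A B where U: "U = V (A, B)" and y: "y \<in> V (A, B)"
      by (metis surj_pair)
    obtain W where W: "W \<in> \<W>" "\<And>z. z \<in> topspace Y \<Longrightarrow> (\<forall>c\<in>I. 1 \<le> f c y \<longrightarrow> \<xi> c < f c z) \<Longrightarrow> z \<in> W"
      using ref[of y] y by (auto simp: V_def)
    have "\<xi> c < f c z" if "z \<in> V (A, B)" "c \<in> I" "1 \<le> f c y" for z c
    proof -
      have "c \<notin> A"
        using y that by (auto simp: V_def)
      moreover have "\<not> f c y < \<xi> c"
        using \<xi>[OF that(2)] that(3) by simp
      ultimately have "c \<in> B"
        using y that(2) by (auto simp: V_def)
      then show ?thesis
        using that(1) by (auto simp: V_def)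
    qed
    then have "U \<subseteq> W"
      using W(2) U by (auto simp: V_def)
    then show ?thesis
      using W by blast
  qed
  then have refi: "refines \<V> \<W>"
    by (simp add: refines_def)
  have "card {U \<in> \<V>. y \<in> U} \<le> Suc m" for y
  proof -
    define P where "P = {p \<in> J. y \<in> V p}"
    \<comment> \<open>When the sizes agree, a \<open>c\<close> in \<open>A - A'\<close> comes with
      some \<open>c'\<close> in \<open>A' - A\<close>, and at \<open>y\<close> each of the two would
      be strictly closer to \<xi> than the other.\<close>
    have sub: "A \<subseteq> A'" if "(A, B) \<in> P" "(A', B') \<in> P" "card A = card A'" for A B A' B'
    proof (rule ccontr)
      assume "\<not> A \<subseteq> A'"
      then obtain c where c: "c \<in> A" "c \<notin> A'"
        by blast
      have fin': "finite A" "A \<subseteq> I" "A' \<subseteq> I"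
        using that fin finite_subset by (auto simp: P_def J_def)
      then have "\<not> A' \<subseteq> A"
        using c that(3) card_subset_eq by metis
      then obtain c' where c': "c' \<in> A'" "c' \<notin> A"
        by blast
      have "\<bar>f c y - \<xi> c\<bar> < \<bar>f c' y - \<xi> c'\<bar>" "\<bar>f c' y - \<xi> c'\<bar> < \<bar>f c y - \<xi> c\<bar>"
        using that c c' fin' by (auto simp: P_def V_def)
      then show False
        by simp
    qed
    have B: "B = {c \<in> I - A. \<xi> c < f c y}" if "(A, B) \<in> P" for A B
    proof -
      have "B \<subseteq> I - A" "\<forall>c\<in>B. \<xi> c < f c y" "\<forall>c\<in>I - A - B. f c y < \<xi> c"
        using that by (auto simp: P_def V_def J_def)
      then show ?thesis
        using less_asym by blast
    qed
    \<comment> \<open>The members containing \<open>y\<close> are told apart by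
      \<open>card A\<close>, since \<open>A\<close> follows from its size and \<open>B\<close> from
      the signs. There are m + 1 sizes from 0 to \<open>m\<close>, and the 1 subtracted in
      \<open>cover_ord\<close> leaves \<open>m\<close>.\<close>
    have "inj_on (card \<circ> fst) P"
    proof (rule inj_onI)
      fix p p' assume p: "p \<in> P" "p' \<in> P" "(card \<circ> fst) p = (card \<circ> fst) p'"
      obtain A B A' B' where [simp]: "p = (A, B)" "p' = (A', B')"
        by (metis surj_pair)
      have "A = A'"
        using sub[of A B A' B'] sub[of A' B' A B] p by auto
      moreover from this have "B = B'"
        using B[of A B] B[of A' B'] p(1,2) by simp
      ultimately show "p = p'"
        by simp
    qed
    moreover have "(card \<circ> fst) ` P \<subseteq> {..m}"
      by (auto simp: P_def J_def)
    ultimately have "card P \<le> Suc m"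
      using card_inj_on_le[of "card \<circ> fst" P "{..m}"] by simp
    moreover have "card {U \<in> \<V>. y \<in> U} \<le> card P"
    proof -
      have "finite P"
        using finJ by (simp add: P_def)
      moreover have "{U \<in> \<V>. y \<in> U} \<subseteq> V ` P"
        by (auto simp: \<V>_def P_def)
      ultimately show ?thesis
        by (meson card_image_le card_mono finite_imageI order_trans)
    qed
    ultimately show ?thesis
      by simp
  qed
  then have "cover_ord Y \<V> \<le> int m"
    using cover by (intro cover_ord_le) (auto simp: finite_open_cover_def)
  then show ?thesis
    using cover_D_le_cover_ord[OF cover refi] by simp
qed

section \<open>Counting over a grid\<close>

text \<open>A union bound. Grid values are \<open>2 * r\<close> apart, so at most one lies within
  \<open>r\<close> of a given number. For fixed \<open>z\<close> and a set \<open>S\<close> of m + 1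
  coordinates, the choices near \<open>h z\<close> on all of \<open>S\<close> are therefore at most
  the fraction \<open>1 / card \<Gamma> ^ Suc m\<close> of all choices, and by \<open>count\<close>
  the pairs \<open>(S, z)\<close> are too few for these to exhaust everything.\<close>

lemma exists_choice_with_few_near_coordinates:
  fixes h :: "'z \<Rightarrow> 'c \<Rightarrow> real" and \<Gamma> :: "real set"
  assumes "finite I" "finite Z" "finite \<Gamma>" "\<Gamma> \<noteq> {}"
    and spread: "\<And>g g'. g \<in> \<Gamma> \<Longrightarrow> g' \<in> \<Gamma> \<Longrightarrow> g \<noteq> g' \<Longrightarrow> 2 * r \<le> \<bar>g - g'\<bar>"
    and count: "2 ^ card I * card Z < card \<Gamma> ^ Suc m"
  obtains \<xi> where "\<xi> \<in> I \<rightarrow>\<^sub>E \<Gamma>" "\<And>z. z \<in> Z \<Longrightarrow> card {c \<in> I. \<bar>\<xi> c - h z c\<bar> < r} \<le> m"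
proof -
  define T where "T = {S. S \<subseteq> I \<and> card S = Suc m}"
  define bad where "bad = (\<lambda>(S, z). {\<xi> \<in> I \<rightarrow>\<^sub>E \<Gamma>. \<forall>c\<in>S. \<bar>\<xi> c - h z c\<bar> < r})"
  have q: "card \<Gamma> > 0"
    using assms by (simp add: card_gt_0_iff)
  have bad: "card (bad (S, z)) * card \<Gamma> ^ Suc m \<le> card \<Gamma> ^ card I" if "S \<in> T" for S z
  proof -
    have S: "S \<subseteq> I" "card S = Suc m"
      using that by (auto simp: T_def)
    \<comment> \<open>The bad choices form a product: the factors off \<open>S\<close> are the whole
      grid, those on \<open>S\<close> have at most one element.\<close>
    define \<Delta> where "\<Delta> = (\<lambda>c. if c \<in> S then {g \<in> \<Gamma>. \<bar>g - h z c\<bar> < r} else \<Gamma>)"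
    have "bad (S, z) = (\<Pi>\<^sub>E c\<in>I. \<Delta> c)"
      using S by (auto simp: bad_def \<Delta>_def PiE_iff extensional_def split: if_splits)
    then have "card (bad (S, z)) = (\<Prod>c\<in>I. card (\<Delta> c))"
      using assms(1) by (simp add: card_PiE)
    also have "\<dots> = (\<Prod>c\<in>S. card (\<Delta> c)) * (\<Prod>c\<in>I - S. card (\<Delta> c))"
      using S assms(1) by (metis mult.commute prod.subset_diff)
    also have "(\<Prod>c\<in>I - S. card (\<Delta> c)) = card \<Gamma> ^ (card I - Suc m)"
      using S assms(1) by (simp add: \<Delta>_def card_Diff_subset finite_subset)
    also have "(\<Prod>c\<in>S. card (\<Delta> c)) \<le> 1"
    proof (rule prod_le_1)
      fix c assume c: "c \<in> S"
      have "g = g'" if "g \<in> \<Delta> c" "g' \<in> \<Delta> c" for g g'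
      proof (rule ccontr)
        assume "g \<noteq> g'"
        then have "2 * r \<le> \<bar>g - g'\<bar>"
          using that c by (intro spread) (auto simp: \<Delta>_def)
        moreover have "\<bar>g - h z c\<bar> < r" "\<bar>g' - h z c\<bar> < r"
          using that c by (auto simp: \<Delta>_def)
        ultimately show False
          by linarith
      qed
      then show "0 \<le> card (\<Delta> c) \<and> card (\<Delta> c) \<le> 1"
        by (metis One_nat_def card_le_Suc0_iff_eq card.infinite le0 le_SucI)
    qed
    finally have "card (bad (S, z)) \<le> card \<Gamma> ^ (card I - Suc m)"
      by simp
    then have "card (bad (S, z)) * card \<Gamma> ^ Suc m \<le> card \<Gamma> ^ (card I - Suc m) * card \<Gamma> ^ Suc m"
      by (rule mult_le_mono1)
    also have "\<dots> = card \<Gamma> ^ card I"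
      using S assms(1) card_mono[of I S] by (subst power_add[symmetric]) simp
    finally show ?thesis .
  qed
  \<comment> \<open>Bounding the number of sets \<open>S\<close> by the number of all subsets is
    crude, but it costs only a constant per site, which is negligible against \<open>ln q\<close> in
    the end.\<close>
  have finT: "finite T" and cardT: "card T \<le> 2 ^ card I"
    using assms(1) card_mono[of "Pow I" T] by (auto simp: T_def card_Pow)
  have "\<exists>\<xi>\<in>I \<rightarrow>\<^sub>E \<Gamma>. \<forall>p\<in>T \<times> Z. \<xi> \<notin> bad p"
  proof (rule ccontr)
    assume "\<not> ?thesis"
    then have "(I \<rightarrow>\<^sub>E \<Gamma>) \<subseteq> (\<Union>p\<in>T \<times> Z. bad p)"
      by blast
    moreover have "finite (\<Union>p\<in>T \<times> Z. bad p)"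
      using finT assms finite_PiE[of I "\<lambda>_. \<Gamma>"] by (auto simp: bad_def)
    ultimately have "card (I \<rightarrow>\<^sub>E \<Gamma>) \<le> card (\<Union>p\<in>T \<times> Z. bad p)"
      by (rule card_mono[rotated])
    also have "\<dots> \<le> (\<Sum>p\<in>T \<times> Z. card (bad p))"
      using finT assms by (intro card_UN_le) auto
    finally have "card \<Gamma> ^ card I * card \<Gamma> ^ Suc m \<le> (\<Sum>p\<in>T \<times> Z. card (bad p)) * card \<Gamma> ^ Suc m"
      using assms(1) by (simp add: card_PiE)
    also have "\<dots> = (\<Sum>p\<in>T \<times> Z. card (bad p) * card \<Gamma> ^ Suc m)"
      by (rule sum_distrib_right)
    also have "\<dots> \<le> (\<Sum>p\<in>T \<times> Z. card \<Gamma> ^ card I)"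
      using bad by (intro sum_mono) auto
    also have "\<dots> = card T * card Z * card \<Gamma> ^ card I"
      by (simp add: card_cartesian_product)
    also have "\<dots> \<le> 2 ^ card I * card Z * card \<Gamma> ^ card I"
      using cardT by simp
    finally have "card \<Gamma> ^ Suc m \<le> 2 ^ card I * card Z"
      using q by (simp add: mult.commute)
    then show False
      using count by simp
  qed
  then obtain \<xi> where \<xi>: "\<xi> \<in> I \<rightarrow>\<^sub>E \<Gamma>" "\<And>S z. S \<in> T \<Longrightarrow> z \<in> Z \<Longrightarrow> \<xi> \<notin> bad (S, z)"
    by blast
  have "card {c \<in> I. \<bar>\<xi> c - h z c\<bar> < r} \<le> m" if "z \<in> Z" for z
  proof (rule ccontr)
    assume "\<not> ?thesis"
    then have "Suc m \<le> card {c \<in> I. \<bar>\<xi> c - h z c\<bar> < r}"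
      by simp
    then obtain S where "S \<subseteq> {c \<in> I. \<bar>\<xi> c - h z c\<bar> < r}" "card S = Suc m"
      by (rule obtain_subset_with_card_n)
    then have "S \<in> T" "\<xi> \<in> bad (S, z)"
      using \<xi>(1) by (auto simp: T_def bad_def)
    then show False
      using \<xi>(2) that by blast
  qed
  then show thesis
    using that \<xi>(1) by blast
qed

section \<open>From the cover to a cube\<close>

text \<open>The functions are distances to the complements of the members, measured in units of a
  Lebesgue number and capped at 1. They will be the coordinates of the map into the cube: a value of
  1 selects a member around the point, and positivity keeps a nearby point inside that
  member.\<close>

lemma Lipschitz_functions_subordinate_to_cover:
  assumes X: "compact_space X" and \<rho>: "compatible_metric X \<rho>" and \<U>: "finite_open_cover X \<U>"
  obtains f :: "'x set \<Rightarrow> 'x \<Rightarrow> real" and C where "C > 0"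
    "\<And>U x y. x \<in> topspace X \<Longrightarrow> y \<in> topspace X \<Longrightarrow> \<bar>f U x - f U y\<bar> \<le> C * \<rho> x y"
    "\<And>U. continuous_map X euclideanreal (f U)"
    "\<And>U x. x \<in> topspace X \<Longrightarrow> 0 < f U x \<Longrightarrow> x \<in> U"
    "\<And>x. x \<in> topspace X \<Longrightarrow> \<exists>U\<in>\<U>. 1 \<le> f U x"
proof -
  interpret M: Metric_space "topspace X" \<rho>
    using \<rho> by (simp add: compatible_metric_def)
  have top: "M.mtopology = X"
    using \<rho> by (simp add: compatible_metric_def)
  have "\<exists>\<epsilon>>0. \<forall>x\<in>topspace X. \<exists>U\<in>\<U>. M.mball x \<epsilon> \<subseteq> U"
    using X \<U> by (intro M.lebesgue_number) (auto simp: top compact_space_def finite_open_cover_def)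
  then obtain l where l: "l > 0" "\<And>x. x \<in> topspace X \<Longrightarrow> \<exists>U\<in>\<U>. M.mball x l \<subseteq> U"
    by blast
  \<comment> \<open>Inserting 1 caps the distance and keeps the infimum over a nonempty set when
    \<open>U\<close> is the whole space.\<close>
  define f where "f = (\<lambda>U x. Inf (insert 1 ((\<lambda>y. \<rho> x y / l) ` (topspace X - U))))"
  have bdd: "bdd_below (insert 1 ((\<lambda>y. \<rho> x y / l) ` S))" for x S
    using l(1) by (intro bdd_belowI[of _ 0]) auto
  have one_sided: "f U x \<le> f U y + 1 / l * \<rho> x y" if xy: "x \<in> topspace X" "y \<in> topspace X" for U x y
  proof -
    have "f U x - 1 / l * \<rho> x y \<le> f U y"
      unfolding f_def
    proof (rule cInf_greatest)
      fix v assume "v \<in> insert 1 ((\<lambda>z. \<rho> y z / l) ` (topspace X - U))"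
      then consider "v = 1" | z where "z \<in> topspace X - U" "v = \<rho> y z / l"
        by blast
      then show "Inf (insert 1 ((\<lambda>z. \<rho> x z / l) ` (topspace X - U))) - 1 / l * \<rho> x y \<le> v"
      proof cases
        case 1
        have "Inf (insert 1 ((\<lambda>z. \<rho> x z / l) ` (topspace X - U))) \<le> 1"
          by (intro cInf_lower bdd) auto
        moreover have "0 \<le> 1 / l * \<rho> x y"
          using l(1) by simp
        ultimately show ?thesis
          using 1 by linarith
      next
        case 2
        have "Inf (insert 1 ((\<lambda>z. \<rho> x z / l) ` (topspace X - U))) \<le> \<rho> x z / l"
          using 2 by (intro cInf_lower bdd) auto
        also have "\<dots> \<le> (\<rho> x y + \<rho> y z) / l"
          using l(1) xy 2 M.triangle by (intro divide_right_mono) auto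
        finally show ?thesis
          using 2 by (simp add: add_divide_distrib)
      qed
    qed simp
    then show ?thesis
      by linarith
  qed
  have lip: "\<bar>f U x - f U y\<bar> \<le> 1 / l * \<rho> x y" if "x \<in> topspace X" "y \<in> topspace X" for U x y
    using one_sided[OF that, of U] one_sided[OF that(2,1), of U, unfolded M.commute[of y x]]
    by linarith
  have cont: "continuous_map X euclideanreal (f U)" for U
  proof -
    have "continuous_map M.mtopology (Metric_space.mtopology UNIV (dist :: real \<Rightarrow> real \<Rightarrow> real)) (f U)"
    proof (subst M.metric_continuous_map)
      show "f U ` topspace X \<subseteq> UNIV \<and> (\<forall>a\<in>topspace X. \<forall>\<epsilon>>0. \<exists>\<delta>>0. \<forall>x. x \<in> topspace X \<and> \<rho> a x < \<delta>
          \<longrightarrow> dist (f U a) (f U x) < \<epsilon>)"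
      proof (intro conjI ballI allI impI)
        fix a and \<epsilon> :: real assume a: "a \<in> topspace X" and "\<epsilon> > 0"
        have "dist (f U a) (f U x) < \<epsilon>" if "x \<in> topspace X" "\<rho> a x < l * \<epsilon>" for x
        proof -
          have "1 / l * \<rho> a x < \<epsilon>"
            using that(2) l(1) by (simp add: field_simps)
          then show ?thesis
            using lip[OF a that(1), of U] unfolding dist_real_def by linarith
        qed
        then show "\<exists>\<delta>>0. \<forall>x. x \<in> topspace X \<and> \<rho> a x < \<delta> \<longrightarrow> dist (f U a) (f U x) < \<epsilon>"
          using l(1) \<open>\<epsilon> > 0\<close> by (intro exI[of _ "l * \<epsilon>"]) auto
      qed simp
    qed (rule Met_TC.Metric_space_axioms)
    then show ?thesis
      by (simp add: top)
  qed
  show thesis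
  proof (rule that[of "1 / l" f])
    show "x \<in> U" if "x \<in> topspace X" "0 < f U x" for U x
    proof (rule ccontr)
      assume "x \<notin> U"
      then have "f U x \<le> \<rho> x x / l"
        unfolding f_def using that(1) by (intro cInf_lower bdd) blast
      then show False
        using that by simp
    qed
    show "\<exists>U\<in>\<U>. 1 \<le> f U x" if x: "x \<in> topspace X" for x
    proof -
      obtain U where U: "U \<in> \<U>" "M.mball x l \<subseteq> U"
        using l(2)[OF x] by blast
      have "1 \<le> f U x"
        unfolding f_def
      proof (rule cInf_greatest)
        fix v assume "v \<in> insert 1 ((\<lambda>y. \<rho> x y / l) ` (topspace X - U))"
        moreover have "l \<le> \<rho> x y" if "y \<in> topspace X - U" for y
          using that U \<open>x \<in> topspace X\<close> by (force simp: M.in_mball)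
        ultimately show "1 \<le> v"
          using l(1) by auto
      qed simp
      then show ?thesis
        using U by blast
    qed
  qed (use l(1) lip cont in auto)
qed

text \<open>Joins the cutting of the cube to the counting, with one coordinate for each pair of a
  cover member and a site. The constant \<open>C\<close> comes from the cover and the metric alone,
  so it stays fixed while \<open>n\<close> grows and \<epsilon> shrinks. \<open>Z\<close> need not
  lie in \<open>Y\<close>: only its size and its closeness to \<open>Y\<close> matter.\<close>

lemma cover_D_power_cover_le:
  assumes X: "compact_space X" and \<rho>: "compatible_metric X \<rho>" and \<U>: "finite_open_cover X \<U>"
  obtains C where "C > 0"
    "\<And>Y Z n q m \<epsilon>. \<lbrakk>Y \<subseteq> {1..n} \<rightarrow>\<^sub>E topspace X; Z \<subseteq> {1..n} \<rightarrow>\<^sub>E topspace X; finite Z;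
        \<And>y. y \<in> Y \<Longrightarrow> \<exists>z\<in>Z. \<forall>a\<in>{1..n}. \<rho> (y a) (z a) < \<epsilon>;
        1 \<le> q; 2 * C * \<epsilon> * (real q + 1) \<le> 1; 2 ^ (card \<U> * n) * card Z < q ^ Suc m\<rbrakk>
      \<Longrightarrow> cover_D (subtopology (product_topology (\<lambda>_. X) {1..n}) Y)
            ((\<lambda>W. W \<inter> Y) ` power_cover n \<U>) \<le> int m"
proof -
  obtain f C where C: "C > 0"
    and lip: "\<And>U x y. x \<in> topspace X \<Longrightarrow> y \<in> topspace X \<Longrightarrow> \<bar>f U x - f U y\<bar> \<le> C * \<rho> x y"
    and cont: "\<And>U. continuous_map X euclideanreal (f U)"
    and pos: "\<And>U x. x \<in> topspace X \<Longrightarrow> 0 < f U x \<Longrightarrow> x \<in> U"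
    and ge1: "\<And>x. x \<in> topspace X \<Longrightarrow> \<exists>U\<in>\<U>. 1 \<le> f U x"
    using Lipschitz_functions_subordinate_to_cover[OF assms] by metis
  show thesis
  proof (rule that[OF C])
    fix Y Z n q m and \<epsilon> :: real
    assume Y: "Y \<subseteq> {1..n} \<rightarrow>\<^sub>E topspace X" and Z: "Z \<subseteq> {1..n} \<rightarrow>\<^sub>E topspace X" "finite Z"
      and net: "\<And>y. y \<in> Y \<Longrightarrow> \<exists>z\<in>Z. \<forall>a\<in>{1..n}. \<rho> (y a) (z a) < \<epsilon>"
      and q: "(1::nat) \<le> q" "2 * C * \<epsilon> * (real q + 1) \<le> 1"
      and count: "2 ^ (card \<U> * n) * card Z < q ^ Suc m"
    define I where "I = \<U> \<times> {1..n}"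
    define g where "g = (\<lambda>(U, a :: nat) y. f U (y a))"
    \<comment> \<open>\<open>r\<close> is half the spacing of the grid, and the hypothesis relating
      \<open>q\<close> and \<epsilon> says that \<open>C * \<epsilon> \<le> r\<close>.\<close>
    define r where "r = 1 / (2 * (real q + 1))"
    \<comment> \<open>The end points 0 and 1 are left out: \<open>\<xi> c < 1\<close> is required
      for cutting the cube, and \<open>\<xi> c > 0\<close> makes values above \<xi>
      positive.\<close>
    define \<Gamma> where "\<Gamma> = (\<lambda>j. real j / (real q + 1)) ` {1..q}"
    let ?T = "subtopology (product_topology (\<lambda>_. X) {1..n}) Y"
    have I: "finite I" "card I = card \<U> * n"
      using \<U> by (auto simp: I_def finite_open_cover_def card_cartesian_product)
    have top: "topspace ?T = Y"
      using Y by (simp add: Int_absorb1)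
    have "inj_on (\<lambda>j. real j / (real q + 1)) {1..q}"
      by (auto simp: inj_on_def)
    then have \<Gamma>: "finite \<Gamma>" "card \<Gamma> = q" "\<Gamma> \<noteq> {}"
      using q by (auto simp: \<Gamma>_def card_image)
    have \<Gamma>01: "0 < t \<and> t < 1" if "t \<in> \<Gamma>" for t
      using that by (auto simp: \<Gamma>_def)
    have spread: "2 * r \<le> \<bar>t - t'\<bar>" if tt': "t \<in> \<Gamma>" "t' \<in> \<Gamma>" "t \<noteq> t'" for t t'
    proof -
      obtain i j where ij: "t = real i / (real q + 1)" "t' = real j / (real q + 1)"
        using tt' by (auto simp: \<Gamma>_def)
      then have "1 \<le> \<bar>real i - real j\<bar>"
        using tt'(3) by (cases i j rule: linorder_cases) auto
      moreover have "t - t' = (real i - real j) / (real q + 1)"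
        by (simp add: ij diff_divide_distrib)
      moreover have "2 * r = 1 / (real q + 1)"
        by (simp add: r_def field_simps)
      ultimately show ?thesis
        by (simp add: divide_right_mono)
    qed
    obtain \<xi> where \<xi>: "\<xi> \<in> I \<rightarrow>\<^sub>E \<Gamma>" "\<And>z. z \<in> Z \<Longrightarrow> card {c \<in> I. \<bar>\<xi> c - g c z\<bar> < r} \<le> m"
      using exists_choice_with_few_near_coordinates[OF I(1) Z(2) \<Gamma>(1,3) spread, of m "\<lambda>z c. g c z"]
        count by (auto simp: I \<Gamma>)
    have \<xi>01: "0 < \<xi> c \<and> \<xi> c < 1" if "c \<in> I" for c
      using \<xi>(1) \<Gamma>01 that by (simp add: PiE_iff)
    show "cover_D ?T ((\<lambda>W. W \<inter> Y) ` power_cover n \<U>) \<le> int m"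
    proof (rule cover_D_le_of_few_coincidences[OF I(1), where f = g and \<xi> = \<xi>], unfold top)
      fix c assume "c \<in> I"
      then obtain U a where "c = (U, a)" "a \<in> {1..n}"
        by (auto simp: I_def)
      then show "continuous_map ?T euclideanreal (g c)"
        using continuous_map_from_subtopology[OF continuous_map_compose[OF
              continuous_map_product_projection[of a "{1..n}" "\<lambda>_. X"] cont[of U]], of Y]
        by (simp add: g_def o_def)
    next
      fix y assume y: "y \<in> Y"
      obtain z where z: "z \<in> Z" "\<And>a. a \<in> {1..n} \<Longrightarrow> \<rho> (y a) (z a) < \<epsilon>"
        using net[OF y] by blast
      have near: "\<bar>g c y - g c z\<bar> < r" if c: "c \<in> I" for c
      proof -
        obtain U a where c: "c = (U, a)" "a \<in> {1..n}"
          using c by (auto simp: I_def)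
        have "\<bar>f U (y a) - f U (z a)\<bar> \<le> C * \<rho> (y a) (z a)"
          using y z(1) Y Z(1) c by (meson PiE_mem subsetD lip)
        also have "\<dots> < C * \<epsilon>"
          using z c C by simp
        also have "\<dots> \<le> r"
          using q(2) by (simp add: r_def field_simps)
        finally show ?thesis
          by (simp add: c g_def)
      qed
      \<comment> \<open>Where \<open>y\<close> meets \<xi>, its net point \<open>z\<close> is within
        \<open>r\<close> of \<xi>, so the bound for the finitely many net points carries over to all
        \<open>y\<close>.\<close>
      have "{c \<in> I. g c y = \<xi> c} \<subseteq> {c \<in> I. \<bar>\<xi> c - g c z\<bar> < r}"
        using near by (metis (mono_tags, lifting) Collect_mono)
      then have "card {c \<in> I. g c y = \<xi> c} \<le> card {c \<in> I. \<bar>\<xi> c - g c z\<bar> < r}"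
        using I(1) by (intro card_mono) auto
      then show "card {c \<in> I. g c y = \<xi> c} \<le> m"
        using \<xi>(2)[OF z(1)] by linarith
    next
      fix y assume y: "y \<in> Y"
      \<comment> \<open>At each site a member is selected on which \<open>y\<close> has value 1. A
        point exceeding \<xi> at these coordinates has positive values there, hence lies in the
        product of the selected members.\<close>
      have "\<forall>a\<in>{1..n}. \<exists>U\<in>\<U>. 1 \<le> f U (y a)"
        using y Y by (meson PiE_mem subsetD ge1)
      then obtain u where u: "\<And>a. a \<in> {1..n} \<Longrightarrow> u a \<in> \<U> \<and> 1 \<le> f (u a) (y a)"
        by metis
      define W where "W = (\<Pi>\<^sub>E a\<in>{1..n}. restrict u {1..n} a)"
      have "W \<in> power_cover n \<U>"
        unfolding power_cover_def W_def using u by (intro imageI) auto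
      moreover have "z \<in> W" if z: "z \<in> Y" "\<forall>c\<in>I. 1 \<le> g c y \<longrightarrow> \<xi> c < g c z" for z
      proof -
        have "z a \<in> u a" if a: "a \<in> {1..n}" for a
        proof (rule pos)
          have "(u a, a) \<in> I"
            using u a by (simp add: I_def)
          then show "0 < f (u a) (z a)"
            using z(2) u[OF a] \<xi>01[of "(u a, a)"] by (fastforce simp: g_def)
          show "z a \<in> topspace X"
            using z(1) Y a by (meson PiE_mem subsetD)
        qed
        then show ?thesis
          using z(1) Y by (auto simp: W_def PiE_iff)
      qed
      ultimately show "\<exists>W\<in>(\<lambda>W. W \<inter> Y) ` power_cover n \<U>. \<forall>z\<in>Y.
          (\<forall>c\<in>I. 1 \<le> g c y \<longrightarrow> \<xi> c < g c z) \<longrightarrow> z \<in> W"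
        by (intro bexI[of _ "W \<inter> Y"]) auto
    qed (use \<xi>01 in blast)
  qed
qed

section \<open>Separated sets as nets\<close>

text \<open>A separated set of largest size is a net, since a point far from all of it could be
  added. That a largest size exists, so that the \<open>Max\<close> in \<open>sep_number\<close> is
  meaningful, comes from total boundedness.\<close>

lemma maximal_separated_set:
  assumes X: "compact_space X" and \<rho>: "compatible_metric X \<rho>"
    and Y: "Y \<subseteq> {1..n} \<rightarrow>\<^sub>E topspace X" and "\<epsilon> > 0" "n > 0"
  obtains Z where "Z \<subseteq> Y" "finite Z" "card Z = sep_number \<epsilon> Y (rho_infty \<rho> n)"
    "\<And>y. y \<in> Y \<Longrightarrow> \<exists>z\<in>Z. \<forall>a\<in>{1..n}. \<rho> (y a) (z a) < \<epsilon>"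
proof -
  interpret M: Metric_space "topspace X" \<rho>
    using \<rho> by (simp add: compatible_metric_def)
  have top: "M.mtopology = X"
    using \<rho> by (simp add: compatible_metric_def)
  have inf_less: "rho_infty \<rho> n y z < \<epsilon> \<longleftrightarrow> (\<forall>a\<in>{1..n}. \<rho> (y a) (z a) < \<epsilon>)" for y z
    unfolding rho_infty_def using \<open>n > 0\<close> by (subst Max_less_iff) auto
  define S where "S = {Z. Z \<subseteq> Y \<and> finite Z \<and> separated_set (rho_infty \<rho> n) \<epsilon> Z}"
  have "M.mtotally_bounded (topspace X)"
    using X by (intro M.compactin_imp_mtotally_bounded) (simp add: top compact_space_def)
  then obtain K where K: "finite K" "K \<subseteq> topspace X" "topspace X \<subseteq> (\<Union>x\<in>K. M.mball x (\<epsilon> / 2))"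
    unfolding M.mtotally_bounded_def using \<open>\<epsilon> > 0\<close> by (meson half_gt_zero)
  then have "\<forall>x\<in>topspace X. \<exists>k\<in>K. \<rho> k x < \<epsilon> / 2"
    by (force simp: M.in_mball)
  then obtain \<kappa> where \<kappa>: "\<And>x. x \<in> topspace X \<Longrightarrow> \<kappa> x \<in> K \<and> \<rho> (\<kappa> x) x < \<epsilon> / 2"
    by metis
  \<comment> \<open>Rounding every site to a finite net of radius \<open>\<epsilon> / 2\<close> is
    injective on a separated set: two maps with the same rounding are closer than \<epsilon> at
    every site.\<close>
  have bound: "card Z \<le> card ({1..n} \<rightarrow>\<^sub>E K)" if "Z \<in> S" for Z
  proof (rule card_inj_on_le[where f = "\<lambda>y. \<lambda>a\<in>{1..n}. \<kappa> (y a)"])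
    have Z: "Z \<subseteq> {1..n} \<rightarrow>\<^sub>E topspace X" "separated_set (rho_infty \<rho> n) \<epsilon> Z"
      using that Y by (auto simp: S_def)
    show "(\<lambda>y. \<lambda>a\<in>{1..n}. \<kappa> (y a)) ` Z \<subseteq> {1..n} \<rightarrow>\<^sub>E K"
      using Z \<kappa> by (fastforce simp: PiE_iff)
    show "inj_on (\<lambda>y. \<lambda>a\<in>{1..n}. \<kappa> (y a)) Z"
    proof (rule inj_onI)
      fix y z assume yz: "y \<in> Z" "z \<in> Z" "(\<lambda>a\<in>{1..n}. \<kappa> (y a)) = (\<lambda>a\<in>{1..n}. \<kappa> (z a))"
      have "\<rho> (y a) (z a) < \<epsilon>" if a: "a \<in> {1..n}" for a
      proof -
        have in_X: "y a \<in> topspace X" "z a \<in> topspace X"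
          using yz Z(1) a by (meson PiE_mem subsetD)+
        have "\<kappa> (y a) = \<kappa> (z a)"
          using fun_cong[OF yz(3), of a] a by simp
        then show ?thesis
          using \<kappa>[OF in_X(1)] \<kappa>[OF in_X(2)] K(2) in_X M.triangle[of "y a" "\<kappa> (y a)" "z a"]
            M.commute[of "y a" "\<kappa> (y a)"] by auto
      qed
      then have "rho_infty \<rho> n y z < \<epsilon>"
        by (simp add: inf_less)
      then show "y = z"
        using Z(2) yz by (fastforce simp: separated_set_def)
    qed
    show "finite ({1..n} \<rightarrow>\<^sub>E K)"
      using K by (intro finite_PiE) auto
  qed
  have "card ` S \<subseteq> {..card ({1..n} \<rightarrow>\<^sub>E K)}"
    using bound by blast
  then have finS: "finite (card ` S)"
    by (rule finite_subset) simp
  have "{} \<in> S"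
    by (auto simp: S_def separated_set_def)
  then have "Max (card ` S) \<in> card ` S"
    using finS by (intro Max_in) auto
  then obtain Z where Z: "Z \<in> S" "card Z = Max (card ` S)"
    by auto
  have "\<exists>z\<in>Z. rho_infty \<rho> n y z < \<epsilon>" if y: "y \<in> Y" for y
  proof (rule ccontr)
    assume far: "\<not> ?thesis"
    have in_X: "y a \<in> topspace X" if "a \<in> {1..n}" for a
      using y Y that by (meson PiE_mem subsetD)
    have "\<rho> (y a) (y a) < \<epsilon>" if "a \<in> {1..n}" for a
      using in_X[OF that] \<open>\<epsilon> > 0\<close> by simp
    then have "y \<notin> Z"
      using far by (auto simp: inf_less)
    have "\<epsilon> \<le> rho_infty \<rho> n y z" if "z \<in> Z" for z
      using far that by force
    moreover have "rho_infty \<rho> n z y = rho_infty \<rho> n y z" for z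
      unfolding rho_infty_def by (subst M.commute) (rule refl)
    ultimately have "\<epsilon> \<le> rho_infty \<rho> n y z \<and> \<epsilon> \<le> rho_infty \<rho> n z y" if "z \<in> Z" for z
      using that by metis
    then have "insert y Z \<in> S"
      using Z(1) y by (auto simp: S_def separated_set_def)
    then have "card (insert y Z) \<le> card Z"
      using finS Z(2) by simp
    moreover have "finite Z"
      using Z(1) by (simp add: S_def)
    ultimately show False
      using \<open>y \<notin> Z\<close> by simp
  qed
  then show thesis
    using that[of Z] Z by (auto simp: S_def sep_number_def inf_less)
qed

section \<open>Change of the compatible metric\<close>

text \<open>By compactness \<open>\<rho>'\<close> is uniformly small where \<rho> is small, and
  bounded by a multiple of \<rho> elsewhere. Squares are used so that the bound can be averaged over
  the sites in \<open>rho_2\<close>.\<close>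

lemma compatible_metrics_square_bound:
  assumes X: "compact_space X" and \<rho>: "compatible_metric X \<rho>" and \<rho>': "compatible_metric X \<rho>'"
    and "\<eta> > 0"
  obtains K where "K > 0"
    "\<And>x y. x \<in> topspace X \<Longrightarrow> y \<in> topspace X \<Longrightarrow> (\<rho>' x y)\<^sup>2 \<le> \<eta> + K * (\<rho> x y)\<^sup>2"
proof -
  interpret M: Metric_space "topspace X" \<rho>
    using \<rho> by (simp add: compatible_metric_def)
  interpret M': Metric_space "topspace X" \<rho>'
    using \<rho>' by (simp add: compatible_metric_def)
  have top: "M.mtopology = X" "M'.mtopology = X"
    using \<rho> \<rho>' by (auto simp: compatible_metric_def)
  define s where "s = sqrt \<eta> / 2"
  have s: "s > 0" "(2 * s)\<^sup>2 = \<eta>"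
    using \<open>\<eta> > 0\<close> by (auto simp: s_def)
  \<comment> \<open>A Lebesgue number, taken with respect to \<rho>, of the cover by
    \<open>\<rho>'\<close>-balls of radius \<open>s\<close>; two points of one such ball are within
    \<open>2 * s\<close>, the root of \<eta>.\<close>
  have "\<exists>\<epsilon>>0. \<forall>x\<in>topspace X. \<exists>U\<in>(\<lambda>z. M'.mball z s) ` topspace X. M.mball x \<epsilon> \<subseteq> U"
  proof (rule M.lebesgue_number)
    show "compactin M.mtopology (topspace X)"
      using X by (simp add: top compact_space_def)
    show "openin M.mtopology U" if "U \<in> (\<lambda>z. M'.mball z s) ` topspace X" for U
      using that M'.openin_mball by (auto simp: top)
  qed (use s in auto)
  then obtain t where t: "t > 0"
    "\<And>x. x \<in> topspace X \<Longrightarrow> \<exists>z\<in>topspace X. M.mball x t \<subseteq> M'.mball z s"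
    by auto
  have "M'.mbounded (topspace X)"
    using X by (intro M'.compactin_imp_mbounded) (simp add: top compact_space_def)
  then obtain B where B: "B > 0" "\<And>x y. x \<in> topspace X \<Longrightarrow> y \<in> topspace X \<Longrightarrow> \<rho>' x y \<le> B"
    unfolding M'.mbounded_alt_pos by blast
  show thesis
  proof (rule that[of "(B / t)\<^sup>2"])
    show "(B / t)\<^sup>2 > 0"
      using B t by simp
    fix x y assume xy: "x \<in> topspace X" "y \<in> topspace X"
    show "(\<rho>' x y)\<^sup>2 \<le> \<eta> + (B / t)\<^sup>2 * (\<rho> x y)\<^sup>2"
    proof (cases "\<rho> x y < t")
      case True
      obtain z where z: "z \<in> topspace X" "M.mball x t \<subseteq> M'.mball z s"
        using t xy by blast
      have "x \<in> M.mball x t" "y \<in> M.mball x t"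
        using xy t True by auto
      then have "x \<in> M'.mball z s" "y \<in> M'.mball z s"
        using z(2) by blast+
      then have "\<rho>' z x < s" "\<rho>' z y < s"
        by (auto simp: M'.in_mball)
      then have "\<rho>' x y \<le> 2 * s"
        using M'.triangle[of x z y] M'.commute[of x z] z xy by simp
      then have "(\<rho>' x y)\<^sup>2 \<le> \<eta>"
        using s(2) power_mono[of "\<rho>' x y" "2 * s" 2] by simp
      then show ?thesis
        by (simp add: add_increasing2)
    next
      case False
      then have "B * 1 \<le> B * (\<rho> x y / t)"
        using B(1) t(1) by (intro mult_left_mono) auto
      then have "\<rho>' x y \<le> B / t * \<rho> x y"
        using B(2)[OF xy] by simp
      then have "(\<rho>' x y)\<^sup>2 \<le> (B / t)\<^sup>2 * (\<rho> x y)\<^sup>2"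
        using power_mono[of "\<rho>' x y" "B / t * \<rho> x y" 2] by (simp only: power_mult_distrib M'.nonneg)
      then show ?thesis
        using \<open>\<eta> > 0\<close> by simp
    qed
  qed
qed

text \<open>The square bound is averaged over the sites. What matters for the limit is that \<delta>
  is chosen before \<open>n\<close> and \<sigma>. The permutation hypothesis keeps the values of
  \<open>\<phi> \<circ> \<sigma> s\<close> on the sites in the space.\<close>

lemma Map_space_change_metric:
  assumes X: "compact_space X" and \<rho>: "compatible_metric X \<rho>" and \<rho>': "compatible_metric X \<rho>'"
    and \<alpha>: "continuous_group_action G X \<alpha>" and F: "F \<subseteq> carrier G" and "\<delta>' > 0"
  obtains \<delta> where "\<delta> > 0"
    "\<And>n \<sigma>. (\<And>s. s \<in> F \<Longrightarrow> \<sigma> s permutes {1..n}) \<Longrightarrow>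
       Map_space X \<alpha> \<rho> F \<delta> n \<sigma> \<subseteq> Map_space X \<alpha> \<rho>' F \<delta>' n \<sigma>"
proof -
  \<comment> \<open>The square of \<open>\<delta>'\<close> is split in halves, one for the additive
    term and one for \<open>K * \<delta>\<^sup>2\<close>.\<close>
  define \<eta> where "\<eta> = \<delta>'\<^sup>2 / 2"
  have \<eta>: "\<eta> > 0"
    using \<open>\<delta>' > 0\<close> by (simp add: \<eta>_def)
  obtain K where K: "K > 0"
    "\<And>x y. x \<in> topspace X \<Longrightarrow> y \<in> topspace X \<Longrightarrow> (\<rho>' x y)\<^sup>2 \<le> \<eta> + K * (\<rho> x y)\<^sup>2"
    using compatible_metrics_square_bound[OF X \<rho> \<rho>' \<eta>] by metis
  define \<delta> where "\<delta> = sqrt (\<eta> / K)"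
  have \<delta>: "\<delta> > 0" "K * \<delta>\<^sup>2 = \<eta>"
    using \<eta> K by (auto simp: \<delta>_def)
  show thesis
  proof (rule that[OF \<delta>(1)], rule subsetI)
    fix n \<sigma> \<phi>
    assume \<sigma>: "\<And>s. s \<in> F \<Longrightarrow> \<sigma> s permutes {1..n}" and \<phi>: "\<phi> \<in> Map_space X \<alpha> \<rho> F \<delta> n \<sigma>"
    have \<phi>X: "\<phi> \<in> {1..n} \<rightarrow>\<^sub>E topspace X"
      using \<phi> by (simp add: Map_space_def)
    have "rho_2 \<rho>' n (\<phi> \<circ> \<sigma> s) (\<alpha> s \<circ> \<phi>) \<le> \<delta>'" if s: "s \<in> F" for s
    proof -
      have le: "rho_2 \<rho> n (\<phi> \<circ> \<sigma> s) (\<alpha> s \<circ> \<phi>) \<le> \<delta>"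
        using \<phi> s by (simp add: Map_space_def)
      let ?S = "\<lambda>\<rho>. \<Sum>a\<in>{1..n}. (\<rho> ((\<phi> \<circ> \<sigma> s) a) ((\<alpha> s \<circ> \<phi>) a))\<^sup>2"
      have "1 / real n * ?S \<rho> \<le> \<delta>\<^sup>2"
        using le \<delta>(1) by (simp add: rho_2_def real_le_lsqrt sqrt_le_D)
      have "?S \<rho>' \<le> (\<Sum>a\<in>{1..n}. \<eta> + K * (\<rho> ((\<phi> \<circ> \<sigma> s) a) ((\<alpha> s \<circ> \<phi>) a))\<^sup>2)"
      proof (intro sum_mono K)
        fix a assume a: "a \<in> {1..n}"
        then have "\<sigma> s a \<in> {1..n}"
          using \<sigma>[OF s] by (metis permutes_in_image)
        then show "(\<phi> \<circ> \<sigma> s) a \<in> topspace X"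
          using \<phi>X by auto
        have "\<alpha> s ` topspace X \<subseteq> topspace X"
          using \<alpha> F s by (auto simp: continuous_group_action_def intro!: continuous_map_image_subset_topspace)
        then show "(\<alpha> s \<circ> \<phi>) a \<in> topspace X"
          using PiE_mem[OF \<phi>X a] by auto
      qed
      also have "\<dots> = real n * \<eta> + K * ?S \<rho>"
        by (simp add: sum.distrib sum_distrib_left)
      finally have "1 / real n * ?S \<rho>' \<le> 1 / real n * (real n * \<eta> + K * ?S \<rho>)"
        by (intro mult_left_mono) auto
      \<comment> \<open>For \<open>n = 0\<close> division by zero makes the left side 0; otherwise
        this is an equality.\<close>
      also have "\<dots> \<le> \<eta> + K * (1 / real n * ?S \<rho>)"
        using \<eta> by (cases "n = 0") (auto simp: field_simps)
      also have "\<dots> \<le> \<eta> + K * \<delta>\<^sup>2"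
        using \<open>1 / real n * ?S \<rho> \<le> \<delta>\<^sup>2\<close> K(1) by (intro add_left_mono mult_left_mono) auto
      also have "\<dots> = \<delta>'\<^sup>2"
        by (simp add: \<delta> \<eta>_def)
      finally show ?thesis
        unfolding rho_2_def using \<open>\<delta>' > 0\<close> by (intro real_le_lsqrt) auto
    qed
    then show "\<phi> \<in> Map_space X \<alpha> \<rho>' F \<delta>' n \<sigma>"
      using \<phi>X by (simp add: Map_space_def)
  qed
qed

section \<open>Growth rates and limits\<close>

text \<open>\<open>m\<close> is the integer part of the logarithm to base \<open>q\<close> of
  \<open>2 ^ (k * n) * N\<close>, the least exponent for which the counting hypothesis is sure to
  hold.\<close>

lemma dimension_le_of_count:
  assumes "2 \<le> q"
  obtains m where "2 ^ (k * n) * N < q ^ Suc m"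
    "real m * ln (real q) \<le> real k * real n * ln 2 + ln (real N)"
proof -
  define t where "t = (real k * real n * ln 2 + ln (real N)) / ln (real q)"
  have q: "ln (real q) > 0"
    using assms by simp
  \<comment> \<open>For \<open>N = 0\<close> this rests on the convention that \<open>ln 0\<close>
    is 0.\<close>
  have t0: "t \<ge> 0"
    using q by (cases "N = 0") (auto simp: t_def)
  define m where "m = nat \<lfloor>t\<rfloor>"
  have m: "real m \<le> t" "t < real (Suc m)"
    using t0 by (auto simp: m_def) linarith
  have t: "t * ln (real q) = real k * real n * ln 2 + ln (real N)"
    using q by (simp add: t_def)
  have "2 ^ (k * n) * N < q ^ Suc m"
  proof (cases "N = 0")
    case True
    then show ?thesis
      using assms by simp
  next
    case False
    have "ln (real (2 ^ (k * n) * N)) = t * ln (real q)"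
      using False by (simp add: t ln_mult ln_realpow)
    also have "\<dots> < real (Suc m) * ln (real q)"
      using m(2) q by (rule mult_strict_right_mono)
    also have "\<dots> = ln (real (q ^ Suc m))"
      using assms by (simp only: of_nat_power ln_realpow)
    finally have "real (2 ^ (k * n) * N) < real (q ^ Suc m)"
      using False assms by (subst (asm) ln_less_cancel_iff) auto
    then show ?thesis
      by (simp only: of_nat_less_iff)
  qed
  moreover have "real m * ln (real q) \<le> t * ln (real q)"
    using m(1) q by (intro mult_right_mono) auto
  ultimately show thesis
    using that t by simp
qed

text \<open>For each \<open>F\<close> and \<open>\<delta>'\<close> a smaller \<delta> puts the map
  space for \<rho> inside the one for \<open>\<rho>'\<close>, and a maximal separated set of the
  latter feeds the counting at every large \<open>i\<close>. A real \<open>D\<close> stands for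
  \<open>D_Sigma\<close>, which may be infinite.\<close>

lemma h_Sigma_lower_bound:
  assumes X: "compact_space X" and \<alpha>: "continuous_group_action G X \<alpha>"
    and sofic: "sofic_approximation G d \<sigma>"
    and \<rho>: "compatible_metric X \<rho>" and \<rho>': "compatible_metric X \<rho>'"
    and \<U>: "finite_open_cover X \<U>"
  obtains C where "C > 0"
    "\<And>D \<epsilon> q. \<lbrakk>0 < \<epsilon>; 2 \<le> q; 2 * C * \<epsilon> * (real q + 1) \<le> 1; ereal D \<le> D_Sigma G X \<alpha> d \<sigma> \<rho> \<U>\<rbrakk>
      \<Longrightarrow> ereal (D * ln (real q) - real (card \<U>) * ln 2) \<le> h_Sigma G X \<alpha> d \<sigma> \<epsilon> \<rho>'"
proof -
  obtain C where C: "C > 0" and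
    cover: "\<And>Y Z n q m \<epsilon>. \<lbrakk>Y \<subseteq> {1..n} \<rightarrow>\<^sub>E topspace X; Z \<subseteq> {1..n} \<rightarrow>\<^sub>E topspace X; finite Z;
        \<And>y. y \<in> Y \<Longrightarrow> \<exists>z\<in>Z. \<forall>a\<in>{1..n}. \<rho>' (y a) (z a) < \<epsilon>;
        1 \<le> q; 2 * C * \<epsilon> * (real q + 1) \<le> 1; 2 ^ (card \<U> * n) * card Z < q ^ Suc m\<rbrakk>
      \<Longrightarrow> cover_D (subtopology (product_topology (\<lambda>_. X) {1..n}) Y)
            ((\<lambda>W. W \<inter> Y) ` power_cover n \<U>) \<le> int m"
    using cover_D_power_cover_le[OF X \<rho>' \<U>] by metis
  show thesis
  proof (rule that[OF C])
    fix D \<epsilon> :: real and q :: nat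
    assume \<epsilon>: "0 < \<epsilon>" and q: "2 \<le> q" "2 * C * \<epsilon> * (real q + 1) \<le> 1"
      and D: "ereal D \<le> D_Sigma G X \<alpha> d \<sigma> \<rho> \<U>"
    define k where "k = card \<U>"
    have lnq: "ln (real q) > 0"
      using q by simp
    show "ereal (D * ln (real q) - real (card \<U>) * ln 2) \<le> h_Sigma G X \<alpha> d \<sigma> \<epsilon> \<rho>'"
      unfolding h_Sigma_def k_def[symmetric]
    proof (intro INF_greatest)
      fix F and \<delta>' :: real
      assume "F \<in> {F. F \<subseteq> carrier G \<and> finite F \<and> F \<noteq> {}}" and "\<delta>' \<in> {0<..}"
      then have F: "F \<subseteq> carrier G" "finite F" "F \<noteq> {}" and \<delta>': "\<delta>' > 0"
        by auto
      obtain \<delta> where \<delta>: "\<delta> > 0" and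
        sub: "\<And>n \<sigma>. (\<And>s. s \<in> F \<Longrightarrow> \<sigma> s permutes {1..n}) \<Longrightarrow>
          Map_space X \<alpha> \<rho> F \<delta> n \<sigma> \<subseteq> Map_space X \<alpha> \<rho>' F \<delta>' n \<sigma>"
        using Map_space_change_metric[OF X \<rho> \<rho>' \<alpha> F(1) \<delta>'] by metis
      define Y where "Y = (\<lambda>i. Map_space X \<alpha> \<rho> F \<delta> (d i) (\<sigma> i))"
      define Y' where "Y' = (\<lambda>i. Map_space X \<alpha> \<rho>' F \<delta>' (d i) (\<sigma> i))"
      define N where "N = (\<lambda>i. sep_number \<epsilon> (Y' i) (rho_infty \<rho>' (d i)))"
      have YY': "Y i \<subseteq> Y' i" for i
        unfolding Y_def Y'_def using sofic F(1) by (intro sub) (auto simp: sofic_approximation_def)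
      have Y'X: "Y' i \<subseteq> {1..d i} \<rightarrow>\<^sub>E topspace X" for i
        by (auto simp: Y'_def Map_space_def)
      have "D_Sigma G X \<alpha> d \<sigma> \<rho> \<U> \<le> D_Sigma_at X \<alpha> d \<sigma> \<U> \<rho> F \<delta>"
        unfolding D_Sigma_def using F \<delta> by (intro INF_lower2[of F] INF_lower2[of \<delta>]) auto
      with D have D_at: "ereal D \<le> D_Sigma_at X \<alpha> d \<sigma> \<U> \<rho> F \<delta>"
        by (rule order_trans)
      \<comment> \<open>A real lower bound excludes the default value of minus infinity, here and,
        through the inclusion, for the larger spaces \<open>Y' i\<close>.\<close>
      have nonempty: "\<not> (\<forall>\<^sub>F i in sequentially. Y i = {})"
      proof
        assume "\<forall>\<^sub>F i in sequentially. Y i = {}"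
        then have "D_Sigma_at X \<alpha> d \<sigma> \<U> \<rho> F \<delta> = -\<infinity>"
          by (simp add: D_Sigma_at_def Y_def)
        then show False
          using D_at by simp
      qed
      have D_lim: "ereal D \<le> limsup (\<lambda>i. ereal (real_of_int (Map_D X \<alpha> \<U> \<rho> F \<delta> (d i) (\<sigma> i)) / real (d i)))"
        using D_at nonempty by (simp add: D_Sigma_at_def Y_def)
      have "\<not> (\<forall>\<^sub>F i in sequentially. Y' i = {})"
        using nonempty YY' by (metis (mono_tags, lifting) eventually_mono subset_empty)
      then have h_at: "h_Sigma_at X \<alpha> d \<sigma> \<epsilon> \<rho>' F \<delta>' = limsup (\<lambda>i. ereal (1 / real (d i) * ln (real (N i))))"
        by (simp add: h_Sigma_at_def Y'_def N_def)
      have Map_D_le: "real_of_int (Map_D X \<alpha> \<U> \<rho> F \<delta> (d i) (\<sigma> i)) / real (d i)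
          \<le> (real k * ln 2 + 1 / real (d i) * ln (real (N i))) / ln (real q)" if di: "d i > 0" for i
      proof -
        \<comment> \<open>The net is taken in the larger space \<open>Y' i\<close>; it still
          approximates every point of \<open>Y i\<close>.\<close>
        obtain Z where Z: "Z \<subseteq> Y' i" "finite Z" "card Z = N i"
          "\<And>y. y \<in> Y' i \<Longrightarrow> \<exists>z\<in>Z. \<forall>a\<in>{1..d i}. \<rho>' (y a) (z a) < \<epsilon>"
          unfolding N_def using maximal_separated_set[OF X \<rho>' Y'X \<epsilon> di] by metis
        obtain m where m: "2 ^ (k * d i) * N i < q ^ Suc m"
          "real m * ln (real q) \<le> real k * real (d i) * ln 2 + ln (real (N i))"
          using dimension_le_of_count[OF q(1)] by metis
        have "Map_D X \<alpha> \<U> \<rho> F \<delta> (d i) (\<sigma> i) \<le> int m"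
          unfolding Map_D_def Y_def[symmetric]
        proof (rule cover)
          show "\<exists>z\<in>Z. \<forall>a\<in>{1..d i}. \<rho>' (y a) (z a) < \<epsilon>"
            if "y \<in> Map_space X \<alpha> \<rho> F \<delta> (d i) (\<sigma> i)" for y
            using Z(4)[of y] YY'[of i] that by (auto simp: Y_def)
          show "Z \<subseteq> {1..d i} \<rightarrow>\<^sub>E topspace X"
            using Z(1) Y'X by blast
          show "2 ^ (card \<U> * d i) * card Z < q ^ Suc m"
            using m(1) by (simp add: Z(3) k_def)
        qed (use Z(2) q in \<open>auto simp: Map_space_def\<close>)
        then have "real_of_int (Map_D X \<alpha> \<U> \<rho> F \<delta> (d i) (\<sigma> i)) \<le> real m"
          by linarith
        then have "real_of_int (Map_D X \<alpha> \<U> \<rho> F \<delta> (d i) (\<sigma> i)) * ln (real q) \<le> real m * ln (real q)"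
          using lnq by (intro mult_right_mono) auto
        with m(2) have "real_of_int (Map_D X \<alpha> \<U> \<rho> F \<delta> (d i) (\<sigma> i)) * ln (real q)
            \<le> real k * real (d i) * ln 2 + ln (real (N i))"
          by linarith
        then show ?thesis
          using lnq di by (simp add: field_simps)
      qed
      have "\<forall>\<^sub>F i in sequentially. 0 < d i"
        using sofic by (simp add: sofic_approximation_def filterlim_at_top Suc_le_eq[symmetric])
      then have ev: "\<forall>\<^sub>F i in sequentially. real_of_int (Map_D X \<alpha> \<U> \<rho> F \<delta> (d i) (\<sigma> i)) / real (d i)
          \<le> (real k * ln 2 + 1 / real (d i) * ln (real (N i))) / ln (real q)"
        by (rule eventually_mono) (rule Map_D_le)
      show "ereal (D * ln (real q) - real k * ln 2) \<le> h_Sigma_at X \<alpha> d \<sigma> \<epsilon> \<rho>' F \<delta>'"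
      \<comment> \<open>A real \<open>r\<close> strictly between the limit superior and the claimed
        bound replaces arithmetic with possibly infinite limits by an eventual inequality between
        reals.\<close>
      proof (rule ccontr)
        assume "\<not> ?thesis"
        then obtain r where r: "limsup (\<lambda>i. ereal (1 / real (d i) * ln (real (N i)))) < ereal r"
          "ereal r < ereal (D * ln (real q) - real k * ln 2)"
          unfolding h_at not_le using ereal_dense2 by blast
        have "\<forall>\<^sub>F i in sequentially. ereal (1 / real (d i) * ln (real (N i))) < ereal r"
          using r(1) by (rule Limsup_lessD)
        with ev have "\<forall>\<^sub>F i in sequentially.
            ereal (real_of_int (Map_D X \<alpha> \<U> \<rho> F \<delta> (d i) (\<sigma> i)) / real (d i))
              \<le> ereal ((real k * ln 2 + r) / ln (real q))"
        proof eventually_elim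
          case (elim i)
          have "(real k * ln 2 + 1 / real (d i) * ln (real (N i))) / ln (real q)
              \<le> (real k * ln 2 + r) / ln (real q)"
            using elim(2) lnq by (intro divide_right_mono) auto
          then show ?case
            using elim(1) by simp
        qed
        then have "limsup (\<lambda>i. ereal (real_of_int (Map_D X \<alpha> \<U> \<rho> F \<delta> (d i) (\<sigma> i)) / real (d i)))
            \<le> ereal ((real k * ln 2 + r) / ln (real q))"
          by (rule Limsup_bounded)
        with D_lim have "D \<le> (real k * ln 2 + r) / ln (real q)"
          using order_trans ereal_less_eq(3) by blast
        then show False
          using r(2) lnq by (simp add: field_simps)
      qed
    qed
  qed
qed

text \<open>For small \<epsilon>, \<open>q \<epsilon>\<close> is the largest integer satisfying the
  grid condition. It lies within 2 of \<open>1 / (2 * C * \<epsilon>)\<close>, and the constant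
  factor is lost in the ratio of logarithms.\<close>

lemma ln_grid_size_asymptotics:
  fixes C :: real
  assumes "C > 0"
  defines "q \<equiv> \<lambda>\<epsilon>. nat \<lfloor>1 / (2 * C * \<epsilon>)\<rfloor> - 1"
  shows "\<forall>\<^sub>F \<epsilon> in at_right 0. 2 \<le> q \<epsilon> \<and> 2 * C * \<epsilon> * (real (q \<epsilon>) + 1) \<le> 1"
    and "((\<lambda>\<epsilon>. ln (real (q \<epsilon>)) / \<bar>ln \<epsilon>\<bar>) \<longlongrightarrow> 1) (at_right 0)"
proof -
  \<comment> \<open>Values of \<open>1 / (2 * C * \<epsilon>)\<close> above 4 make the natural
    subtraction in \<open>q\<close> exact and keep the lower estimate in the sandwich above
    2.\<close>
  have "\<forall>\<^sub>F \<epsilon> in at_right 0. 3 < 1 / (2 * C * \<epsilon>) - 1 \<and> 0 < \<epsilon> \<and> \<epsilon> < 1"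
    using assms(1) by (intro eventually_conj; real_asymp)
  then have ev: "\<forall>\<^sub>F \<epsilon> in at_right 0. 0 < \<epsilon> \<and> \<epsilon> < 1 \<and> 2 < 1 / (2 * C * \<epsilon>) - 2 \<and>
      1 / (2 * C * \<epsilon>) - 2 \<le> real (q \<epsilon>) \<and> real (q \<epsilon>) + 1 \<le> 1 / (2 * C * \<epsilon>)"
  proof (rule eventually_mono)
    fix \<epsilon> assume \<epsilon>: "3 < 1 / (2 * C * \<epsilon>) - 1 \<and> 0 < \<epsilon> \<and> \<epsilon> < 1"
    define t where "t = 1 / (2 * C * \<epsilon>)"
    have t: "3 < t - 1" "q \<epsilon> = nat \<lfloor>t\<rfloor> - 1"
      using \<epsilon> by (auto simp: t_def q_def)
    have "4 \<le> \<lfloor>t\<rfloor>"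
      using t by linarith
    then have "real (q \<epsilon>) = real (nat \<lfloor>t\<rfloor>) - 1" "real (nat \<lfloor>t\<rfloor>) = real_of_int \<lfloor>t\<rfloor>"
      unfolding t(2) by linarith+
    then have "2 < t - 2 \<and> t - 2 \<le> real (q \<epsilon>) \<and> real (q \<epsilon>) + 1 \<le> t"
      using t by linarith
    then show "0 < \<epsilon> \<and> \<epsilon> < 1 \<and> 2 < 1 / (2 * C * \<epsilon>) - 2 \<and>
      1 / (2 * C * \<epsilon>) - 2 \<le> real (q \<epsilon>) \<and> real (q \<epsilon>) + 1 \<le> 1 / (2 * C * \<epsilon>)"
      using \<epsilon> by (simp add: t_def)
  qed
  then show "\<forall>\<^sub>F \<epsilon> in at_right 0. 2 \<le> q \<epsilon> \<and> 2 * C * \<epsilon> * (real (q \<epsilon>) + 1) \<le> 1"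
  proof eventually_elim
    case (elim \<epsilon>)
    then have "2 < real (q \<epsilon>)" "2 * C * \<epsilon> > 0"
      using assms(1) by (linarith, simp)
    then show ?case
      using elim by (simp add: pos_le_divide_eq mult.commute)
  qed
  show "((\<lambda>\<epsilon>. ln (real (q \<epsilon>)) / \<bar>ln \<epsilon>\<bar>) \<longlongrightarrow> 1) (at_right 0)"
  proof (rule tendsto_sandwich)
    show "((\<lambda>\<epsilon>. ln (1 / (2 * C * \<epsilon>) - 2) / \<bar>ln \<epsilon>\<bar>) \<longlongrightarrow> 1) (at_right 0)"
      using assms(1) by real_asymp
    show "((\<lambda>\<epsilon>. ln (1 / (2 * C * \<epsilon>)) / \<bar>ln \<epsilon>\<bar>) \<longlongrightarrow> 1) (at_right 0)"
      using assms(1) by real_asymp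
    show "\<forall>\<^sub>F \<epsilon> in at_right 0. ln (1 / (2 * C * \<epsilon>) - 2) / \<bar>ln \<epsilon>\<bar> \<le> ln (real (q \<epsilon>)) / \<bar>ln \<epsilon>\<bar>"
      using ev by eventually_elim (intro divide_right_mono ln_mono; linarith)
    show "\<forall>\<^sub>F \<epsilon> in at_right 0. ln (real (q \<epsilon>)) / \<bar>ln \<epsilon>\<bar> \<le> ln (1 / (2 * C * \<epsilon>)) / \<bar>ln \<epsilon>\<bar>"
      using ev by eventually_elim (intro divide_right_mono ln_mono; linarith)
  qed
qed

lemma D_Sigma_le_sofic_metric_mdim_at:
  assumes "compact_space X" "continuous_group_action G X \<alpha>" "sofic_approximation G d \<sigma>"
    "compatible_metric X \<rho>" "compatible_metric X \<rho>'" "finite_open_cover X \<U>"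
  shows "D_Sigma G X \<alpha> d \<sigma> \<rho> \<U> \<le> sofic_metric_mdim_at G X \<alpha> d \<sigma> \<rho>'"
proof -
  obtain C where C: "C > 0" and
    bound: "\<And>D \<epsilon> q. \<lbrakk>0 < \<epsilon>; 2 \<le> q; 2 * C * \<epsilon> * (real q + 1) \<le> 1; ereal D \<le> D_Sigma G X \<alpha> d \<sigma> \<rho> \<U>\<rbrakk>
      \<Longrightarrow> ereal (D * ln (real q) - real (card \<U>) * ln 2) \<le> h_Sigma G X \<alpha> d \<sigma> \<epsilon> \<rho>'"
    using h_Sigma_lower_bound[OF assms] by metis
  have "ereal D \<le> sofic_metric_mdim_at G X \<alpha> d \<sigma> \<rho>'" if D: "ereal D \<le> D_Sigma G X \<alpha> d \<sigma> \<rho> \<U>" for D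
  proof -
    define q where "q = (\<lambda>\<epsilon>. nat \<lfloor>1 / (2 * C * \<epsilon>)\<rfloor> - 1)"
    \<comment> \<open>The lower bound for \<open>h_Sigma\<close> divided by
      \<open>\<bar>ln \<epsilon>\<bar>\<close>: the first term tends to \<open>D\<close>, the cost
      \<open>k ln 2\<close> of the crude counting to 0.\<close>
    define v where "v = (\<lambda>\<epsilon>. D * (ln (real (q \<epsilon>)) / \<bar>ln \<epsilon>\<bar>) - real (card \<U>) * ln 2 * (1 / \<bar>ln \<epsilon>\<bar>))"
    have "((\<lambda>\<epsilon>::real. 1 / \<bar>ln \<epsilon>\<bar>) \<longlongrightarrow> 0) (at_right 0)"
      by real_asymp
    then have "(v \<longlongrightarrow> D * 1 - real (card \<U>) * ln 2 * 0) (at_right 0)"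
      unfolding v_def q_def by (intro tendsto_intros ln_grid_size_asymptotics C)
    then have "((\<lambda>\<epsilon>. ereal (v \<epsilon>)) \<longlongrightarrow> ereal D) (at_right 0)"
      by simp
    then have "ereal D = Liminf (at_right 0) (\<lambda>\<epsilon>. ereal (v \<epsilon>))"
      by (intro lim_imp_Liminf[symmetric]) auto
    also have "\<dots> \<le> Liminf (at_right 0) (\<lambda>\<epsilon>. h_Sigma G X \<alpha> d \<sigma> \<epsilon> \<rho>' / ereal \<bar>ln \<epsilon>\<bar>)"
    proof (rule Liminf_mono)
      have "\<forall>\<^sub>F \<epsilon> in at_right 0. 0 < \<epsilon> \<and> \<epsilon> < (1::real)"
        by (intro eventually_conj; real_asymp)
      moreover have "\<forall>\<^sub>F \<epsilon> in at_right 0. 2 \<le> q \<epsilon> \<and> 2 * C * \<epsilon> * (real (q \<epsilon>) + 1) \<le> 1"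
        unfolding q_def by (rule ln_grid_size_asymptotics(1)[OF C])
      ultimately
      show "\<forall>\<^sub>F \<epsilon> in at_right 0. ereal (v \<epsilon>) \<le> h_Sigma G X \<alpha> d \<sigma> \<epsilon> \<rho>' / ereal \<bar>ln \<epsilon>\<bar>"
      proof eventually_elim
        case (elim \<epsilon>)
        have pos: "\<bar>ln \<epsilon>\<bar> > 0"
          using elim by simp
        have "ereal (v \<epsilon>) = ereal (D * ln (real (q \<epsilon>)) - real (card \<U>) * ln 2) / ereal \<bar>ln \<epsilon>\<bar>"
          using pos by (simp add: v_def diff_divide_distrib)
        also have "\<dots> \<le> h_Sigma G X \<alpha> d \<sigma> \<epsilon> \<rho>' / ereal \<bar>ln \<epsilon>\<bar>"
          using pos elim D by (intro ereal_divide_right_mono bound) auto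
        finally show ?case .
      qed
    qed
    finally show ?thesis
      by (simp add: sofic_metric_mdim_at_def)
  qed
  then show ?thesis
    \<comment> \<open>If the inequality failed, a real number would lie strictly between the two
      sides; this also covers infinite values.\<close>
    by (meson ereal_dense2 less_imp_le not_le)
qed

theorem theorem6p1:
  fixes G :: "('g, 'm) monoid_scheme"
    and X :: "'x topology"
    and \<alpha> :: "'g \<Rightarrow> 'x \<Rightarrow> 'x"
    and d :: "nat \<Rightarrow> nat"
    and \<sigma> :: "nat \<Rightarrow> 'g \<Rightarrow> nat \<Rightarrow> nat"
    and \<rho> :: "'x \<Rightarrow> 'x \<Rightarrow> real"
  assumes "group G" and "countable (carrier G)"
    and "compact_space X" and "metrizable_space X"
    and "continuous_group_action G X \<alpha>"
    and "sofic_approximation G d \<sigma>"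
    and "compatible_metric X \<rho>"
  shows "sofic_mdim G X \<alpha> d \<sigma> \<rho> \<le> sofic_metric_mdim G X \<alpha> d \<sigma>"
  \<comment> \<open>The supremum over covers and the infimum over metrics reduce the claim to one
    cover and one metric. That metric may differ from \<rho>, which is why two metrics are carried
    through.\<close>
  unfolding sofic_mdim_def sofic_metric_mdim_def
  using assms by (intro SUP_least INF_greatest D_Sigma_le_sofic_metric_mdim_at) auto

end
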